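(* Let $G$ be a residually finite group, and let $\mathcal{N}$ be a family of finite-index normal subgroups of $G$ that is closed under finite intersections and such that $\bigcap_{N\in\mathcal{N}}N=\{1\}$. Let $k\in\mathbb{N}$, and suppose that there exists a constant $\alpha>0$ such that $\mathrm{dc}^k(G/N)\ge\alpha$ for every $N\in\mathcal{N}$. Then $G$ has a $k$-step nilpotent subgroup of finite index.
   Context: Simple commutators are defined by $[x_1,x_2]=x_1^{-1}x_2^{-1}x_1x_2$ and $[x_1,\ldots,x_k]=[[x_1,\ldots,x_{k-1}],x_k]$. A group is $k$-step nilpotent if all $(k+1)$-fold simple commutators of its elements are trivial (nilpotent of class at most $k$). For a finite group $Q$, $\mathrm{dc}^k(Q)$ is the probability that $[x_1,\ldots,x_{k+1}]=1$ when $x_1,\ldots,x_{k+1}$ are chosen independently and uniformly at random from $Q$. The group $G$ is not assumed finitely generated. *)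

theory Defs
  imports "HOL-Algebra.Coset" "HOL-Probability.Probability_Mass_Function"
begin

(* The library's derived subgroup is built from x \<otimes> y \<otimes> inv x \<otimes> inv y; here the inverses come first. *)
definition commutator :: "('a, 'b) monoid_scheme \<Rightarrow> 'a \<Rightarrow> 'a \<Rightarrow> 'a" where
  "commutator G x y = inv\<^bsub>G\<^esub> x \<otimes>\<^bsub>G\<^esub> inv\<^bsub>G\<^esub> y \<otimes>\<^bsub>G\<^esub> x \<otimes>\<^bsub>G\<^esub> y"

(* [x1, ..., xk] = [[x1, ..., x(k-1)], xk], with the 1-fold commutator [x] = x.
   The value on the empty list is a dummy. *)
fun simple_commutator :: "('a, 'b) monoid_scheme \<Rightarrow> 'a list \<Rightarrow> 'a" where
  "simple_commutator G [] = \<one>\<^bsub>G\<^esub>"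
| "simple_commutator G (x # xs) = foldl (commutator G) x xs"

definition step_nilpotent :: "nat \<Rightarrow> ('a, 'b) monoid_scheme \<Rightarrow> bool" where
  "step_nilpotent k G \<longleftrightarrow> group G \<and>
     (\<forall>xs. length xs = k + 1 \<and> set xs \<subseteq> carrier G \<longrightarrow> simple_commutator G xs = \<one>\<^bsub>G\<^esub>)"

(* Only meaningful for finite Q: pmf_of_set is unspecified on infinite sets. *)
definition dc :: "nat \<Rightarrow> ('a, 'b) monoid_scheme \<Rightarrow> real" where
  "dc k Q = measure_pmf.prob (replicate_pmf (k + 1) (pmf_of_set (carrier Q)))
              {xs. simple_commutator Q xs = \<one>\<^bsub>Q\<^esub>}"

definition finite_index :: "'a set \<Rightarrow> ('a, 'b) monoid_scheme \<Rightarrow> bool" where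
  "finite_index H G \<longleftrightarrow> subgroup H G \<and> finite (rcosets\<^bsub>G\<^esub> H)"

definition residually_finite :: "('a, 'b) monoid_scheme \<Rightarrow> bool" where
  "residually_finite G \<longleftrightarrow> group G \<and>
     (\<forall>g \<in> carrier G - {\<one>\<^bsub>G\<^esub>}. \<exists>N. N \<lhd> G \<and> finite_index N G \<and> g \<notin> N)"

end

theory Submission
  imports Defs
begin

text \<open>For a finite group \<open>Q\<close> with a surjection onto \<open>R\<close> and kernel
  \<open>K\<close>, averaging over fibres shows: if \<open>dc k Q > (1 - 1/2^(k+1)) dc k R\<close>, then for some
  cosets of \<open>K\<close> the relation \<open>[x\<^sub>1, ..., x\<^sub>k\<^sub>+\<^sub>1] = 1\<close> holds with probability more than
  \<open>1 - 1/2^(k+1)\<close> for \<open>x\<^sub>i\<close> in the \<open>i\<close>-th coset. Fix \<open>w = [x\<^sub>1, ..., x\<^sub>k]\<close>. The elements of the last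
  coset commuting with \<open>w\<close> make up at most half of it, unless \<open>w\<close> centralizes \<open>K\<close>; so
  \<open>[x\<^sub>1, ..., x\<^sub>k]\<close> lies in the centralizer of \<open>K\<close> with probability more than
  \<open>1 - 1/2^k\<close>. Repeating this modulo that centralizer, \<open>K\<close> is \<open>k\<close>-step nilpotent. In the theorem,
  choose \<open>N\<close> with \<open>dc k (G/N)\<close> so close to the infimum over the family that this applies to
  \<open>G/(M \<inter> N) \<rightarrow> G/N\<close> for all members \<open>M\<close>; then \<open>N\<close> is \<open>k\<close>-step nilpotent.\<close>

section \<open>Uniform random tuples, and \<open>dc\<close> as a counting ratio\<close>

lemma replicate_pmf_of_set:
  assumes "finite A" "A \<noteq> {}"
  shows "replicate_pmf n (pmf_of_set A) = pmf_of_set {xs. set xs \<subseteq> A \<and> length xs = n}"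
proof (induction n)
  case 0
  have "{xs. set xs \<subseteq> A \<and> length xs = 0} = {[]}"
    by auto
  then show ?case
    by (simp add: pmf_of_set_singleton)
next
  case (Suc n)
  let ?L = "\<lambda>n. {xs. set xs \<subseteq> A \<and> length xs = n}"
  have fin: "finite (?L n)"
    using assms(1) by (rule finite_lists_length_eq)
  obtain a where "a \<in> A"
    using assms(2) by blast
  then have "replicate n a \<in> ?L n"
    by auto
  then have ne: "?L n \<noteq> {}"
    by blast
  have "replicate_pmf (Suc n) (pmf_of_set A) =
      map_pmf (\<lambda>(x, xs). x # xs) (pair_pmf (pmf_of_set A) (pmf_of_set (?L n)))"
    by (simp add: Suc pair_pmf_def map_pmf_def bind_assoc_pmf bind_return_pmf)
  also have "pair_pmf (pmf_of_set A) (pmf_of_set (?L n)) = pmf_of_set (A \<times> ?L n)"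
  proof (rule pmf_eqI)
    fix i
    have "finite (A \<times> ?L n)" "A \<times> ?L n \<noteq> {}"
      using assms fin ne by simp_all
    then show "pmf (pair_pmf (pmf_of_set A) (pmf_of_set (?L n))) i = pmf (pmf_of_set (A \<times> ?L n)) i"
      using pmf_of_set[OF assms(2,1)] pmf_of_set[OF ne fin] pmf_of_set[of "A \<times> ?L n"]
      by (cases i) (simp add: pmf_pair card_cartesian_product indicator_times)
  qed
  also have "map_pmf (\<lambda>(x, xs). x # xs) \<dots> = pmf_of_set ((\<lambda>(x, xs). x # xs) ` (A \<times> ?L n))"
    using assms fin ne by (intro map_pmf_of_set_inj) (auto simp: inj_on_def)
  also have "(\<lambda>(x, xs). x # xs) ` (A \<times> ?L n) = ?L (Suc n)"
    by (auto simp: length_Suc_conv image_iff)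
  finally show ?case .
qed

lemma dc_eq_card:
  assumes "finite (carrier G)" "carrier G \<noteq> {}"
  shows "dc k G = real (card {xs. set xs \<subseteq> carrier G \<and> length xs = k + 1 \<and>
      simple_commutator G xs = \<one>\<^bsub>G\<^esub>}) / real (card (carrier G)) ^ (k + 1)"
proof -
  let ?L = "{xs. set xs \<subseteq> carrier G \<and> length xs = k + 1}"
  have fin: "finite ?L"
    using assms(1) by (rule finite_lists_length_eq)
  obtain a where "a \<in> carrier G"
    using assms(2) by blast
  then have "replicate (k + 1) a \<in> ?L"
    by auto
  then have ne: "?L \<noteq> {}"
    by blast
  have "?L \<inter> {xs. simple_commutator G xs = \<one>\<^bsub>G\<^esub>} =
      {xs. set xs \<subseteq> carrier G \<and> length xs = k + 1 \<and> simple_commutator G xs = \<one>\<^bsub>G\<^esub>}"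
    by auto
  then show ?thesis
    unfolding dc_def replicate_pmf_of_set[OF assms] measure_pmf_of_set[OF ne fin]
    by (simp only: card_lists_length_eq[OF assms(1)] of_nat_power)
qed

section \<open>Commutator identities and centralizers modulo a normal subgroup\<close>

context group
begin

lemma commutator_closed [simp]:
  "x \<in> carrier G \<Longrightarrow> y \<in> carrier G \<Longrightarrow> commutator G x y \<in> carrier G"
  by (simp add: commutator_def)

lemma commutator_one_right [simp]: "x \<in> carrier G \<Longrightarrow> commutator G x \<one> = \<one>"
  by (simp add: commutator_def)

lemma inv_mult_cancel_left [simp]:
  assumes "x \<in> carrier G" "y \<in> carrier G"
  shows "inv x \<otimes> (x \<otimes> y) = y" "x \<otimes> (inv x \<otimes> y) = y"
  using assms by (simp_all flip: m_assoc)

lemma inv_commutator: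
  "x \<in> carrier G \<Longrightarrow> y \<in> carrier G \<Longrightarrow> inv (commutator G x y) = commutator G y x"
  by (simp add: commutator_def inv_mult_group m_assoc)

lemma commutator_mult_right:
  "x \<in> carrier G \<Longrightarrow> y \<in> carrier G \<Longrightarrow> z \<in> carrier G \<Longrightarrow>
    commutator G x (y \<otimes> z) = commutator G x z \<otimes> (inv z \<otimes> commutator G x y \<otimes> z)"
  by (simp add: commutator_def inv_mult_group m_assoc)

lemma commutator_inv_right:
  "x \<in> carrier G \<Longrightarrow> y \<in> carrier G \<Longrightarrow>
    commutator G x (inv y) = y \<otimes> commutator G y x \<otimes> inv y"
  by (simp add: commutator_def m_assoc)

lemma commutator_conjugate:
  "h \<in> carrier G \<Longrightarrow> x \<in> carrier G \<Longrightarrow> y \<in> carrier G \<Longrightarrow>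
    commutator G (h \<otimes> x \<otimes> inv h) y = h \<otimes> commutator G x (inv h \<otimes> y \<otimes> h) \<otimes> inv h"
  by (simp add: commutator_def inv_mult_group m_assoc)

lemma simple_commutator_snoc:
  "xs \<noteq> [] \<Longrightarrow> simple_commutator G (xs @ [y]) = commutator G (simple_commutator G xs) y"
  by (cases xs) simp_all

lemma simple_commutator_closed:
  "set xs \<subseteq> carrier G \<Longrightarrow> simple_commutator G xs \<in> carrier G"
  by (induction xs rule: rev_induct)
    (simp, case_tac "xs = []", simp_all add: simple_commutator_snoc)

text \<open>Modulo \<open>Z\<close> this is the centralizer of \<open>x\<close>. Closure holds
  because \<open>[x, y z]\<close> and \<open>[x, inv y]\<close> are products of conjugates of
  \<open>[x, y]\<close>, \<open>[x, z]\<close> and their inverses.\<close>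

lemma subgroup_commutator_in_normal:
  assumes "Z \<lhd> G" "x \<in> carrier G"
  shows "subgroup {y \<in> carrier G. commutator G x y \<in> Z} G"
proof -
  interpret Z: normal Z G by fact
  show ?thesis
  proof (rule subgroupI)
    show "{y \<in> carrier G. commutator G x y \<in> Z} \<noteq> {}"
      using assms(2) Z.one_closed by auto
  next
    fix y assume "y \<in> {y \<in> carrier G. commutator G x y \<in> Z}"
    then have y: "y \<in> carrier G" "commutator G x y \<in> Z" by auto
    then have "commutator G y x \<in> Z"
      by (metis Z.m_inv_closed assms(2) inv_commutator)
    with y show "inv y \<in> {y \<in> carrier G. commutator G x y \<in> Z}"
      using assms(2) Z.inv_op_closed2 by (simp add: commutator_inv_right)
  next
    fix y z
    assume "y \<in> {y \<in> carrier G. commutator G x y \<in> Z}" "z \<in> {y \<in> carrier G. commutator G x y \<in> Z}"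
    then show "y \<otimes> z \<in> {y \<in> carrier G. commutator G x y \<in> Z}"
      using assms(2) Z.inv_op_closed1 by (simp add: commutator_mult_right)
  qed auto
qed

text \<open>This is the preimage of the centralizer of the image of \<open>N\<close> in
  \<open>G Mod Z\<close>. The later induction on commutator length replaces \<open>Z\<close> by such
  a subgroup, so it has to be normal again.\<close>

lemma normal_centralizer_modulo:
  assumes Z: "Z \<lhd> G" and N: "N \<lhd> G"
  shows "{g \<in> carrier G. \<forall>n\<in>N. commutator G g n \<in> Z} \<lhd> G"
proof -
  interpret Z: normal Z G by fact
  interpret N: normal N G by fact
  \<comment> \<open>Reversing a commutator inverts it, so the fixed element \<open>n\<close> can be
    moved to the left, where \<open>subgroup_commutator_in_normal\<close> applies.\<close>
  have sym: "commutator G y x \<in> Z \<longleftrightarrow> commutator G x y \<in> Z" if "x \<in> carrier G" "y \<in> carrier G" for x y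
    using that by (metis Z.m_inv_closed inv_commutator)
  define T where "T n = {g \<in> carrier G. commutator G n g \<in> Z}" for n
  have N_carrier: "n \<in> carrier G" if "n \<in> N" for n
    using that N.subset by blast
  let ?C = "{g \<in> carrier G. \<forall>n\<in>N. commutator G g n \<in> Z}"
  have "?C = \<Inter> (T ` N)"
    unfolding T_def using sym N.one_closed N_carrier by blast
  moreover have "subgroup (\<Inter> (T ` N)) G"
  proof (rule subgroups_Inter)
    show "T ` N \<noteq> {}"
      using N.one_closed by blast
  qed (use N_carrier subgroup_commutator_in_normal[OF Z] in \<open>auto simp: T_def\<close>)
  \<comment> \<open>\<open>[h g inv h, n]\<close> is a conjugate of \<open>[g, inv h n h]\<close>,
    and \<open>inv h n h\<close> is again in \<open>N\<close>.\<close>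
  moreover have "h \<otimes> g \<otimes> inv h \<in> ?C" if "h \<in> carrier G" "g \<in> ?C" for g h
    using that N.inv_op_closed1 Z.inv_op_closed2 N_carrier by (simp add: commutator_conjugate)
  ultimately show ?thesis
    by (simp add: normal_inv_iff)
qed

end

section \<open>Fibres of a homomorphism\<close>

context group_hom
begin

lemma hom_commutator:
  "x \<in> carrier G \<Longrightarrow> y \<in> carrier G \<Longrightarrow> h (commutator G x y) = commutator H (h x) (h y)"
  by (simp add: commutator_def)

lemma hom_simple_commutator:
  "set xs \<subseteq> carrier G \<Longrightarrow> h (simple_commutator G xs) = simple_commutator H (map h xs)"
proof (induction xs rule: rev_induct)
  case (snoc x xs)
  then show ?case
    by (cases "xs = []")
      (simp_all add: G.simple_commutator_snoc H.simple_commutator_snoc hom_commutator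
        G.simple_commutator_closed)
qed simp

text \<open>A coset of the kernel if \<open>r\<close> is in the image of \<open>h\<close>, and empty
  otherwise.\<close>

definition fibre :: "'c \<Rightarrow> 'a set" where
  "fibre r = {x \<in> carrier G. h x = r}"

definition fibres :: "'c list \<Rightarrow> 'a list set" where
  "fibres rs = {xs. set xs \<subseteq> carrier G \<and> map h xs = rs}"

lemma finite_fibre: "finite (carrier G) \<Longrightarrow> finite (fibre r)"
  by (simp add: fibre_def)

lemma finite_fibres: "finite (carrier G) \<Longrightarrow> finite (fibres rs)"
  by (rule finite_subset[OF _ finite_lists_length_eq[of "carrier G" "length rs"]])
    (auto simp: fibres_def)

lemma fibres_Nil: "fibres [] = {[]}"
  by (auto simp: fibres_def)

lemma fibres_snoc: "fibres (rs @ [r]) = (\<lambda>(ys, y). ys @ [y]) ` (fibres rs \<times> fibre r)"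
proof (intro equalityI subsetI)
  fix xs assume "xs \<in> fibres (rs @ [r])"
  then show "xs \<in> (\<lambda>(ys, y). ys @ [y]) ` (fibres rs \<times> fibre r)"
    by (cases xs rule: rev_cases) (auto simp: fibres_def fibre_def)
qed (auto simp: fibres_def fibre_def)

lemma inj_on_snoc: "inj_on (\<lambda>(ys, y). ys @ [y]) A"
  by (auto simp: inj_on_def)

text \<open>Left translation by the inverse of one element of \<open>T\<close> in the fibre carries
  all of them into the kernel without leaving \<open>T\<close>.\<close>

lemma card_subgroup_Int_fibre_le:
  assumes T: "subgroup T G" and fin: "finite (carrier G)"
  shows "card (T \<inter> fibre r) \<le> card (T \<inter> kernel G H h)"
proof (cases "T \<inter> fibre r = {}")
  case False
  then obtain a where a: "a \<in> T" "a \<in> carrier G" "h a = r"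
    by (auto simp: fibre_def)
  show ?thesis
  proof (rule card_inj_on_le)
    show "inj_on (\<lambda>x. inv a \<otimes> x) (T \<inter> fibre r)"
      using a by (auto simp: inj_on_def fibre_def)
    show "(\<lambda>x. inv a \<otimes> x) ` (T \<inter> fibre r) \<subseteq> T \<inter> kernel G H h"
      using a T by (auto simp: fibre_def kernel_def intro: subgroup.m_closed subgroup.m_inv_closed)
    show "finite (T \<inter> kernel G H h)"
      using fin by (simp add: kernel_def)
  qed
qed simp

lemma card_fibre_le:
  assumes "finite (carrier G)"
  shows "card (fibre r) \<le> card (kernel G H h)"
proof -
  have "carrier G \<inter> fibre r = fibre r" "carrier G \<inter> kernel G H h = kernel G H h"
    by (auto simp: fibre_def kernel_def)
  with card_subgroup_Int_fibre_le[OF G.subgroup_self assms, of r] show ?thesis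
    by simp
qed

lemma card_fibres_le:
  assumes fin: "finite (carrier G)"
  shows "card (fibres rs) \<le> card (kernel G H h) ^ length rs"
proof (induction rs rule: rev_induct)
  case (snoc r rs)
  have "card (fibres (rs @ [r])) = card (fibres rs) * card (fibre r)"
    by (simp add: fibres_snoc card_image[OF inj_on_snoc] card_cartesian_product)
  also have "\<dots> \<le> card (kernel G H h) ^ length rs * card (kernel G H h)"
    using snoc card_fibre_le[OF fin] by (rule mult_le_mono)
  finally show ?case
    by (simp add: mult.commute)
qed (simp add: fibres_Nil)

text \<open>If \<open>T\<close> met the kernel in a proper subgroup, that subgroup would have index
  at least 2, and by \<open>card_subgroup_Int_fibre_le\<close> no fibre could contain more elements
  of \<open>T\<close> than half the size of the kernel.\<close>

lemma kernel_subset_if_large_fibre: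
  assumes T: "subgroup T G" and fin: "finite (carrier G)"
    and large: "card (kernel G H h) < 2 * card (T \<inter> fibre r)"
  shows "kernel G H h \<subseteq> T"
proof (rule ccontr)
  let ?K = "kernel G H h"
  assume "\<not> ?K \<subseteq> T"
  then obtain a where a: "a \<in> ?K" "a \<notin> T"
    by blast
  have K: "subgroup ?K G"
    by (rule subgroup_kernel)
  have aG: "a \<in> carrier G"
    by (rule subgroup.mem_carrier[OF K a(1)])
  have fins: "finite (T \<inter> ?K)" "finite ?K"
    using fin by (simp_all add: kernel_def)
  have inj: "inj_on (\<lambda>x. a \<otimes> x) (T \<inter> ?K)"
    using aG subgroup.mem_carrier[OF K] by (auto simp: inj_on_def)
  \<comment> \<open>If \<open>x\<close> and \<open>a \<otimes> x\<close> were both in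
    \<open>T\<close>, so would be \<open>a\<close>. Hence \<open>T \<inter> ?K\<close> and its
    translate are disjoint subsets of \<open>?K\<close> of equal size.\<close>
  have disj: "(T \<inter> ?K) \<inter> (\<lambda>x. a \<otimes> x) ` (T \<inter> ?K) = {}"
  proof -
    have False if "x \<in> T" "a \<otimes> x \<in> T" for x
    proof -
      have "(a \<otimes> x) \<otimes> inv x \<in> T"
        by (rule subgroup.m_closed[OF T that(2) subgroup.m_inv_closed[OF T that(1)]])
      then show False
        using a aG subgroup.mem_carrier[OF T that(1)] by (simp add: G.m_assoc)
    qed
    then show ?thesis
      by blast
  qed
  have "2 * card (T \<inter> ?K) = card ((T \<inter> ?K) \<union> (\<lambda>x. a \<otimes> x) ` (T \<inter> ?K))"
    using fins disj by (simp add: card_Un_disjoint card_image[OF inj])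
  also have "\<dots> \<le> card ?K"
    using a subgroup.m_closed[OF K] fins by (intro card_mono) auto
  finally show False
    using large card_subgroup_Int_fibre_le[OF T fin, of r] by simp
qed

section \<open>Counting tuples in given fibres whose commutator lies in a normal subgroup\<close>

definition fibres_into :: "'a set \<Rightarrow> 'c list \<Rightarrow> 'a list set" where
  "fibres_into Z rs = {xs \<in> fibres rs. simple_commutator G xs \<in> Z}"

text \<open>Fix all coordinates but the last. The last one has at most as many choices as the kernel
  has elements, and at most half as many unless the commutator of the others lies in
  \<open>C\<close>. The factor 2 keeps the count in the natural numbers.\<close>

lemma card_fibres_into_snoc_le:
  assumes fin: "finite (carrier G)" and Z: "Z \<lhd> G" and ne: "rs \<noteq> []"
  defines "C \<equiv> {g \<in> carrier G. \<forall>n\<in>kernel G H h. commutator G g n \<in> Z}"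
  shows "2 * card (fibres_into Z (rs @ [r])) \<le>
    card (kernel G H h) * (card (kernel G H h) ^ length rs + card (fibres_into C rs))"
proof -
  let ?K = "kernel G H h"
  define F where "F ys = {y \<in> fibre r. commutator G (simple_commutator G ys) y \<in> Z}" for ys
  \<comment> \<open>Appending \<open>y\<close> to the empty list yields \<open>y\<close> itself
    instead of a commutator, so \<open>simple_commutator_snoc\<close> requires this.\<close>
  have nonempty: "ys \<noteq> []" if "ys \<in> fibres rs" for ys
    using that ne by (auto simp: fibres_def)
  have fs: "finite (fibres rs)"
    using fin by (rule finite_fibres)
  have "fibres_into Z (rs @ [r]) = (\<lambda>(ys, y). ys @ [y]) ` (SIGMA ys:fibres rs. F ys)"
    using nonempty
    by (auto simp: fibres_into_def fibres_snoc F_def G.simple_commutator_snoc image_iff split: prod.splits)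
  then have "card (fibres_into Z (rs @ [r])) = (\<Sum>ys\<in>fibres rs. card (F ys))"
    using fs finite_fibre[OF fin]
    by (simp add: card_image[OF inj_on_snoc] card_SigmaI F_def)
  then have "2 * card (fibres_into Z (rs @ [r])) = (\<Sum>ys\<in>fibres rs. 2 * card (F ys))"
    by (simp add: sum_distrib_left)
  also have "\<dots> \<le> (\<Sum>ys\<in>fibres rs. card ?K + (if simple_commutator G ys \<in> C then card ?K else 0))"
  proof (rule sum_mono)
    fix ys assume "ys \<in> fibres rs"
    then have w: "simple_commutator G ys \<in> carrier G"
      by (intro G.simple_commutator_closed) (simp add: fibres_def)
    let ?T = "{y \<in> carrier G. commutator G (simple_commutator G ys) y \<in> Z}"
    have F: "F ys = ?T \<inter> fibre r"
      by (auto simp: F_def fibre_def)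
    have "card (F ys) \<le> card (fibre r)"
      by (rule card_mono) (auto simp: F_def finite_fibre[OF fin])
    then have "card (F ys) \<le> card ?K"
      using card_fibre_le[OF fin, of r] by linarith
    \<comment> \<open>Outside \<open>C\<close>, the commutator of \<open>ys\<close> fails to commute
      modulo \<open>Z\<close> with some kernel element, so the subgroup \<open>?T\<close> does not
      contain the kernel.\<close>
    moreover have "2 * card (F ys) \<le> card ?K" if "simple_commutator G ys \<notin> C"
    proof -
      have "\<not> ?K \<subseteq> ?T"
        using that w by (auto simp: C_def kernel_def)
      with kernel_subset_if_large_fibre[OF G.subgroup_commutator_in_normal[OF Z w] fin, of r]
      show ?thesis
        unfolding F by linarith
    qed
    ultimately show "2 * card (F ys) \<le> card ?K + (if simple_commutator G ys \<in> C then card ?K else 0)"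
      by simp
  qed
  also have "\<dots> = card ?K * (card (fibres rs) + card (fibres_into C rs))"
    using fs by (simp add: sum.distrib fibres_into_def distrib_left sum.If_cases Int_def)
  also have "\<dots> \<le> card ?K * (card ?K ^ length rs + card (fibres_into C rs))"
    using card_fibres_le[OF fin, of rs] by simp
  finally show ?thesis .
qed

text \<open>Induction on the number of fibres, with \<open>Z\<close> varying: dropping the last
  fibre replaces \<open>Z\<close> by the centralizer \<open>C\<close> of the kernel modulo
  \<open>Z\<close>. The threshold is made for this step, since
  \<open>2 * (1 - 1/2^(n+1)) - 1 = 1 - 1/2^n\<close>.\<close>

lemma kernel_simple_commutator_in_normal:
  assumes fin: "finite (carrier G)" and Z: "Z \<lhd> G"
    and large: "(1 - 1 / 2 ^ length rs) * real (card (kernel G H h)) ^ length rs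
      < real (card (fibres_into Z rs))"
    and rs: "rs \<noteq> []" and xs: "length xs = length rs" "set xs \<subseteq> kernel G H h"
  shows "simple_commutator G xs \<in> Z"
  using rs Z large xs
proof (induction rs arbitrary: Z xs rule: rev_nonempty_induct)
  case (single r)
  then interpret Z: normal Z G by simp
  have "fibres_into Z [r] = (\<lambda>y. [y]) ` (Z \<inter> fibre r)"
  proof -
    have "fibres [r] = (\<lambda>y. [y]) ` fibre r"
      by (auto simp: fibres_def fibre_def)
    then show ?thesis
      by (auto simp: fibres_into_def)
  qed
  then have "card (fibres_into Z [r]) = card (Z \<inter> fibre r)"
    by (simp add: card_image inj_on_def)
  \<comment> \<open>For a single fibre the threshold is one half.\<close>
  with single have "card (kernel G H h) < 2 * card (Z \<inter> fibre r)"
    by simp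
  then have "kernel G H h \<subseteq> Z"
    by (rule kernel_subset_if_large_fibre[OF Z.subgroup_axioms fin])
  with single show ?case
    by (cases xs) auto
next
  case (snoc r rs)
  let ?K = "kernel G H h"
  let ?k = "real (card ?K)"
  define C where "C = {g \<in> carrier G. \<forall>n\<in>?K. commutator G g n \<in> Z}"
  have C: "C \<lhd> G"
    unfolding C_def by (rule G.normal_centralizer_modulo[OF snoc.prems(1) normal_kernel])
  have "finite ?K" "?K \<noteq> {}"
    using fin by (auto simp: kernel_def)
  then have pos: "?k > 0"
    by (simp add: card_gt_0_iff)
  have "real (2 * card (fibres_into Z (rs @ [r]))) \<le> real (card ?K * (card ?K ^ length rs + card (fibres_into C rs)))"
    using card_fibres_into_snoc_le[OF fin snoc.prems(1) snoc.hyps, of r] unfolding C_def of_nat_le_iff .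
  then have "2 * real (card (fibres_into Z (rs @ [r]))) \<le> ?k * (?k ^ length rs + real (card (fibres_into C rs)))"
    by simp
  moreover have "(1 - 1 / 2 ^ Suc (length rs)) * (?k * ?k ^ length rs) < real (card (fibres_into Z (rs @ [r])))"
    using snoc.prems(2) by simp
  then have "?k * (2 * (1 - 1 / 2 ^ Suc (length rs)) * ?k ^ length rs) < 2 * real (card (fibres_into Z (rs @ [r])))"
    by (simp only: mult_ac)
  ultimately have "?k * (2 * (1 - 1 / 2 ^ Suc (length rs)) * ?k ^ length rs) < ?k * (?k ^ length rs + real (card (fibres_into C rs)))"
    by linarith
  then have "2 * (1 - 1 / 2 ^ Suc (length rs)) * ?k ^ length rs < ?k ^ length rs + real (card (fibres_into C rs))"
    using pos by (simp only: mult_less_cancel_left_pos)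
  then have large: "(1 - 1 / 2 ^ length rs) * ?k ^ length rs < real (card (fibres_into C rs))"
    by (simp add: algebra_simps)
  obtain ys y where xs: "xs = ys @ [y]"
    using snoc.prems(3) by (cases xs rule: rev_cases) auto
  with snoc.prems snoc.hyps have ys: "length ys = length rs" "set ys \<subseteq> ?K" "y \<in> ?K" "ys \<noteq> []"
    by auto
  have "simple_commutator G ys \<in> C"
    by (rule snoc.IH[OF C large ys(1,2)])
  \<comment> \<open>By definition of \<open>C\<close>, the commutator of \<open>ys\<close> commutes
    modulo \<open>Z\<close> with the kernel element \<open>y\<close>.\<close>
  with ys show ?case
    by (simp add: xs G.simple_commutator_snoc C_def)
qed

end

section \<open>Comparing \<open>dc\<close> of a finite group and of its image\<close>

lemma (in group_hom) card_eq_image_times_kernel: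
  assumes surj: "h ` carrier G = carrier H"
  shows "card (carrier G) = card (carrier H) * card (kernel G H h)"
proof -
  have "card (rcosets\<^bsub>G\<^esub> (kernel G H h)) = card (carrier H)"
    using iso_same_card[OF FactGroup_iso[OF surj]] by (simp add: FactGroup_def)
  then show ?thesis
    using G.lagrange[OF subgroup_kernel] by (simp add: Coset.order_def)
qed

text \<open>Averaging: a tuple of \<open>G\<close> with trivial commutator lies over such a tuple of
  \<open>H\<close>. If none of the latter had more than the proportion \<open>1 - 1/2^(k+1)\<close>
  of good tuples above it, \<open>dc k G\<close> would be too small for
  \<open>large\<close>.\<close>

lemma (in group_hom) kernel_simple_commutator_eq_one:
  assumes fin: "finite (carrier G)" and surj: "h ` carrier G = carrier H"
    and large: "(1 - 1 / 2 ^ (k + 1)) * dc k H < dc k G"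
    and xs: "length xs = k + 1" "set xs \<subseteq> kernel G H h"
  shows "simple_commutator G xs = \<one>"
proof (rule ccontr)
  assume nontriv: "simple_commutator G xs \<noteq> \<one>"
  let ?k = "real (card (kernel G H h))"
  let ?c = "1 - 1 / 2 ^ (k + 1) :: real"
  let ?A = "{rs. set rs \<subseteq> carrier H \<and> length rs = k + 1 \<and> simple_commutator H rs = \<one>\<^bsub>H\<^esub>}"
  let ?B = "{ys. set ys \<subseteq> carrier G \<and> length ys = k + 1 \<and> simple_commutator G ys = \<one>}"
  have finH: "finite (carrier H)"
    using fin surj by (metis finite_imageI)
  have finA: "finite ?A"
    by (rule finite_subset[OF _ finite_lists_length_eq[OF finH, of "k + 1"]]) blast
  \<comment> \<open>A tuple of fibres beyond this bound would make every commutator of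
    \<open>k + 1\<close> kernel elements trivial, by the case \<open>Z = {\<one>}\<close>, against
    the choice of \<open>xs\<close>.\<close>
  have few: "real (card (fibres_into {\<one>} rs)) \<le> ?c * ?k ^ (k + 1)" if "rs \<in> ?A" for rs
  proof (rule ccontr)
    assume "\<not> real (card (fibres_into {\<one>} rs)) \<le> ?c * ?k ^ (k + 1)"
    then have "simple_commutator G xs \<in> {\<one>}"
      using that xs
      by (intro kernel_simple_commutator_in_normal[OF fin G.one_is_normal, of rs]) auto
    with nontriv show False
      by simp
  qed
  have "?B \<subseteq> (\<Union>rs\<in>?A. fibres_into {\<one>} rs)"
  proof
    fix ys assume ys: "ys \<in> ?B"
    then have "map h ys \<in> ?A"
      using hom_simple_commutator[of ys] by (auto simp: surj[symmetric])
    moreover have "ys \<in> fibres_into {\<one>} (map h ys)"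
      using ys by (simp add: fibres_into_def fibres_def)
    ultimately show "ys \<in> (\<Union>rs\<in>?A. fibres_into {\<one>} rs)"
      by blast
  qed
  then have "card ?B \<le> card (\<Union>rs\<in>?A. fibres_into {\<one>} rs)"
    by (rule card_mono[rotated])
      (use finA finite_fibres[OF fin] in \<open>simp add: fibres_into_def\<close>)
  also have "\<dots> \<le> (\<Sum>rs\<in>?A. card (fibres_into {\<one>} rs))"
    by (rule card_UN_le[OF finA])
  finally have "real (card ?B) \<le> real (\<Sum>rs\<in>?A. card (fibres_into {\<one>} rs))"
    by (simp only: of_nat_le_iff)
  also have "\<dots> = (\<Sum>rs\<in>?A. real (card (fibres_into {\<one>} rs)))"
    by (rule of_nat_sum)
  also have "\<dots> \<le> real (card ?A) * (?c * ?k ^ (k + 1))"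
    by (rule sum_bounded_above) (rule few)
  finally have B: "real (card ?B) \<le> real (card ?A) * (?c * ?k ^ (k + 1))" .
  have neG: "carrier G \<noteq> {}" and neH: "carrier H \<noteq> {}"
    by auto
  have "?k > 0"
    using fin G.one_closed by (auto simp: kernel_def card_gt_0_iff)
  moreover have "real (card (carrier H)) > 0"
    using finH neH by (simp add: card_gt_0_iff)
  \<comment> \<open>The order of \<open>G\<close> is that of \<open>H\<close> times
    \<open>?k\<close>, so the powers of \<open>?k\<close> cancel afterwards.\<close>
  moreover have "dc k G \<le> real (card ?A) * (?c * ?k ^ (k + 1)) / (real (card (carrier H)) * ?k) ^ (k + 1)"
    using B unfolding dc_eq_card[OF fin neG] card_eq_image_times_kernel[OF surj] of_nat_mult
    by (intro divide_right_mono) simp_all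
  ultimately have "dc k G \<le> ?c * dc k H"
    unfolding dc_eq_card[OF finH neH] by (simp only: power_mult_distrib) (simp add: mult.commute)
  with large show False
    by simp
qed

text \<open>The finite result is applied to the projection from \<open>G Mod L\<close> to
  \<open>G Mod N\<close>, whose kernel consists of the cosets of \<open>L\<close> in
  \<open>N\<close>.\<close>

lemma (in group) simple_commutator_in_normal_if_dc_close:
  assumes N: "N \<lhd> G" and L: "L \<lhd> G" and "L \<subseteq> N" and fin: "finite (rcosets L)"
    and large: "(1 - 1 / 2 ^ (k + 1)) * dc k (G Mod N) < dc k (G Mod L)"
    and xs: "length xs = k + 1" "set xs \<subseteq> N"
  shows "simple_commutator G xs \<in> L"
proof -
  interpret N: normal N G by fact
  interpret L: normal L G by fact
  \<comment> \<open>This makes the projection \<open>\<pi>\<close> well defined.\<close>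
  have N_eq: "N #> x = N #> y" if xy: "x \<in> carrier G" "y \<in> carrier G" "L #> x = L #> y" for x y
  proof -
    have "y \<in> L #> x"
      using xy rcos_self[OF xy(2) L.subgroup_axioms] by simp
    then have "y \<in> N #> x"
      using \<open>L \<subseteq> N\<close> by (auto simp: r_coset_def)
    then show ?thesis
      using repr_independence xy(1) N.subgroup_axioms by blast
  qed
  obtain \<pi> where \<pi>: "\<pi> \<in> hom (G Mod L) (G Mod N)" "\<And>x. x \<in> carrier G \<Longrightarrow> \<pi> (L #> x) = N #> x"
    by (rule FactGroup_universal[OF N.r_coset_hom_Mod L N_eq]) auto
  interpret \<pi>: group_hom "G Mod L" "G Mod N" \<pi>
    using \<pi>(1) by (simp add: group_hom_def group_hom_axioms_def L.factorgroup_is_group N.factorgroup_is_group)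
  interpret q: group_hom G "G Mod L" "\<lambda>x. L #> x"
    using L.r_coset_hom_Mod by (simp add: group_hom_def group_hom_axioms_def L.factorgroup_is_group is_group)
  have xs_carrier: "set xs \<subseteq> carrier G"
    using xs(2) N.subset by blast
  have "simple_commutator (G Mod L) (map (\<lambda>x. L #> x) xs) = \<one>\<^bsub>G Mod L\<^esub>"
  proof (rule \<pi>.kernel_simple_commutator_eq_one[OF _ _ large])
    show "finite (carrier (G Mod L))"
      using fin by (simp add: FactGroup_def)
    show "\<pi> ` carrier (G Mod L) = carrier (G Mod N)"
      using \<pi>(2) by (simp add: carrier_FactGroup image_image)
    show "set (map (\<lambda>x. L #> x) xs) \<subseteq> kernel (G Mod L) (G Mod N) \<pi>"
    proof
      fix c assume "c \<in> set (map (\<lambda>x. L #> x) xs)"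
      then obtain x where x: "x \<in> N" "c = L #> x"
        using xs(2) by auto
      then have "x \<in> carrier G"
        using N.subset by blast
      then show "c \<in> kernel (G Mod L) (G Mod N) \<pi>"
        using x \<pi>(2) N.rcos_const[OF is_group x(1)] by (auto simp: kernel_def carrier_FactGroup)
    qed
  qed (use xs in simp)
  then have "L #> simple_commutator G xs = L"
    using q.hom_simple_commutator[OF xs_carrier] by simp
  then show ?thesis
    using rcos_self[OF simple_commutator_closed[OF xs_carrier] L.subgroup_axioms] by simp
qed

lemma (in group) simple_commutator_subgroup:
  assumes "subgroup N G" "set xs \<subseteq> N"
  shows "simple_commutator (G\<lparr>carrier := N\<rparr>) xs = simple_commutator G xs"
proof -
  have "(\<lambda>x. x) \<in> hom (G\<lparr>carrier := N\<rparr>) G"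
    using subgroup.subset[OF assms(1)] by (auto simp: hom_def)
  then interpret i: group_hom "G\<lparr>carrier := N\<rparr>" G "\<lambda>x. x"
    using subgroup_imp_group[OF assms(1)] by (simp add: group_hom_def group_hom_axioms_def is_group)
  show ?thesis
    using i.hom_simple_commutator[of xs] assms(2) by simp
qed

section \<open>Choice of a member of the family near the infimum\<close>

theorem theorem1p19:
  fixes G :: "('a, 'b) monoid_scheme"
    and \<N> :: "'a set set"
    and k :: nat
    and \<alpha> :: real
  assumes "residually_finite G"
    and "\<And>N. N \<in> \<N> \<Longrightarrow> N \<lhd> G \<and> finite_index N G"
    and "\<And>M N. M \<in> \<N> \<Longrightarrow> N \<in> \<N> \<Longrightarrow> M \<inter> N \<in> \<N>"
    and "carrier G \<inter> \<Inter>\<N> = {\<one>\<^bsub>G\<^esub>}"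
    and "\<alpha> > 0"
    and "\<And>N. N \<in> \<N> \<Longrightarrow> dc k (G Mod N) \<ge> \<alpha>"
  shows "\<exists>H. finite_index H G \<and> step_nilpotent k (G\<lparr>carrier := H\<rparr>)"
proof -
  interpret group G
    using assms(1) unfolding residually_finite_def by blast
  show ?thesis
  proof (cases "\<N> = {}")
    \<comment> \<open>The intersection of the empty family is the universe, so \<open>G\<close> is
      trivial and the whole group is the witness.\<close>
    case True
    with assms(4) have triv: "carrier G = {\<one>\<^bsub>G\<^esub>}"
      by simp
    have "rcosets\<^bsub>G\<^esub> (carrier G) \<subseteq> Pow (carrier G)"
      by (rule rcosets_subset_PowG[OF subgroup_self])
    moreover have "finite (Pow (carrier G))"
      using triv by simp
    ultimately have "finite_index (carrier G) G"
      using subgroup_self finite_subset unfolding finite_index_def by blast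
    moreover have "step_nilpotent k (G\<lparr>carrier := carrier G\<rparr>)"
      unfolding step_nilpotent_def
    proof (intro conjI allI impI)
      show "group (G\<lparr>carrier := carrier G\<rparr>)"
        by (rule subgroup_imp_group[OF subgroup_self])
      fix xs assume "length xs = k + 1 \<and> set xs \<subseteq> carrier (G\<lparr>carrier := carrier G\<rparr>)"
      then have "set xs \<subseteq> carrier G"
        by simp
      then have "simple_commutator (G\<lparr>carrier := carrier G\<rparr>) xs \<in> {\<one>\<^bsub>G\<^esub>}"
        using simple_commutator_subgroup[OF subgroup_self] simple_commutator_closed
        unfolding triv[symmetric] by metis
      then show "simple_commutator (G\<lparr>carrier := carrier G\<rparr>) xs = \<one>\<^bsub>G\<lparr>carrier := carrier G\<rparr>\<^esub>"
        by simp
    qed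
    ultimately show ?thesis
      by blast
  next
    case False
    let ?d = "\<lambda>N. dc k (G Mod N)"
    let ?c = "1 - 1 / 2 ^ (k + 1) :: real"
    have bdd: "bdd_below (?d ` \<N>)"
      by (rule bdd_belowI2[of _ \<alpha>]) (rule assms(6))
    \<comment> \<open>The uniform bound \<open>\<alpha>\<close> keeps the infimum positive, so
      dividing it by \<open>?c < 1\<close> strictly increases it and some member has its value in
      the gap.\<close>
    have "Inf (?d ` \<N>) \<ge> \<alpha>"
      by (rule cINF_greatest[OF False assms(6)])
    with \<open>\<alpha> > 0\<close> have pos: "Inf (?d ` \<N>) > 0"
      by simp
    have "(2::real) ^ (k + 1) > 1"
      by (rule one_less_power) simp_all
    then have c: "0 < ?c" "?c < 1"
      by simp_all
    then have "Inf (?d ` \<N>) < Inf (?d ` \<N>) / ?c"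
      using pos by (simp only: pos_less_divide_eq mult_less_cancel_left2) simp
    then obtain N where N: "N \<in> \<N>" "?d N < Inf (?d ` \<N>) / ?c"
      using cInf_lessD[of "?d ` \<N>"] False by blast
    have close: "?c * ?d N < ?d M" if "M \<in> \<N>" for M
    proof -
      have "?c * ?d N < Inf (?d ` \<N>)"
        using N(2) c(1) by (simp only: pos_less_divide_eq mult.commute)
      also have "\<dots> \<le> ?d M"
        using that bdd by (intro cINF_lower)
      finally show ?thesis .
    qed
    have N_sub: "subgroup N G"
      using assms(2)[OF N(1)] by (simp add: finite_index_def)
    have "simple_commutator G xs = \<one>\<^bsub>G\<^esub>" if xs: "length xs = k + 1" "set xs \<subseteq> N" for xs
    proof -
      \<comment> \<open>\<open>M\<close> may fail to lie inside \<open>N\<close>, so the quotient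
        lemma is applied to \<open>M \<inter> N\<close>, which belongs to the family and therefore
        satisfies \<open>close\<close>.\<close>
      have "simple_commutator G xs \<in> M" if "M \<in> \<N>" for M
      proof -
        have MN: "M \<inter> N \<in> \<N>"
          using assms(3) that N(1) by blast
        have "simple_commutator G xs \<in> M \<inter> N"
          using assms(2)[OF N(1)] assms(2)[OF MN] close[OF MN] xs
          by (intro simple_commutator_in_normal_if_dc_close[of N "M \<inter> N" k])
            (simp_all add: finite_index_def)
        then show ?thesis
          by blast
      qed
      moreover have "simple_commutator G xs \<in> carrier G"
        using xs(2) subgroup.subset[OF N_sub] by (intro simple_commutator_closed) blast
      \<comment> \<open>The commutator lies in every member, and the members intersect
        trivially.\<close>
      ultimately show ?thesis
        using assms(4) by blast
    qed
    then have "step_nilpotent k (G\<lparr>carrier := N\<rparr>)"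
      using subgroup_imp_group[OF N_sub] simple_commutator_subgroup[OF N_sub]
      by (auto simp: step_nilpotent_def)
    then show ?thesis
      using assms(2)[OF N(1)] by blast
  qed
qed

end
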